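(* For every integer $m\geq 2$, $$\sum_{k=1}^{\infty}(2k-1)(\zeta(2k)-1)F_{2k+m+1}=\frac{\pi^2}{2}\sec^2\left(\frac{\sqrt{5}\,\pi}{2}\right)F_{m+3}-\frac{9F_m+7F_{m-1}}{2}$$ and $$\sum_{k=1}^{\infty}(2k-1)(\zeta(2k)-1)L_{2k+m+1}=\frac{\pi^2}{2}\sec^2\left(\frac{\sqrt{5}\,\pi}{2}\right)L_{m+3}-\frac{9L_m+7L_{m-1}}{2}.$$
   Context: $\zeta$ denotes the Riemann zeta function. $F_n$ and $L_n$ denote the Fibonacci and Lucas numbers: both satisfy $x_n=x_{n-1}+x_{n-2}$ for $n\ge 2$, with $F_0=0$, $F_1=1$ and $L_0=2$, $L_1=1$. *)

theory Defs
  imports "HOL-Analysis.Analysis" "HOL-Number_Theory.Fib"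
begin

(* The Riemann zeta function on the real half-line s > 1, where it is given by its
   Dirichlet series. For s <= 1 the series diverges and the value below is junk,
   not the analytic continuation. *)
definition zeta :: "real \<Rightarrow> real" where
  "zeta s = (\<Sum>n. 1 / real (Suc n) powr s)"

fun lucas :: "nat \<Rightarrow> nat" where
  "lucas 0 = 2"
| "lucas (Suc 0) = 1"
| "lucas (Suc (Suc n)) = lucas (Suc n) + lucas n"

end

theory Submission
  imports Defs
begin

text \<open>
  The Fibonacci and Lucas numbers are linear combinations of \<open>\<phi>\<^sup>n\<close> and \<open>\<psi>\<^sup>n\<close>, where
  \<open>\<phi>\<close> and \<open>\<psi>\<close> are the two roots of \<open>r\<^sup>2 = r + 1\<close>, and both sides of the claimed identities
  are linear in the sequence. So it is enough to treat the sequence \<open>r\<^sup>n\<close> for each root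
  (\<open>golden_root_sums\<close>), that is, to evaluate the even power series
  \<open>G(x) = \<Sum>\<^sub>k (2k - 1) (\<zeta>(2k) - 1) x\<^sup>2\<^sup>k\<close> at \<open>x = r\<close>.

  Expand \<open>\<zeta>(2k) - 1\<close> as the sum of \<open>n\<^sup>-\<^sup>2\<^sup>k\<close> over \<open>n \<ge> 2\<close> and exchange the two summations, which
  is harmless since all terms are nonnegative. The inner sum is a differentiated geometric
  series with the value \<open>(x\<^sup>2 / 2) (1 / (n - x)\<^sup>2 + 1 / (n + x)\<^sup>2)\<close>, so \<open>G(x)\<close> is \<open>x\<^sup>2 / 2\<close> times the
  partial fraction expansion of \<open>\<pi>\<^sup>2 / sin\<^sup>2(\<pi> x)\<close> with its poles at \<open>0\<close>, \<open>1\<close> and \<open>-1\<close> removed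
  (\<open>zeta_even_generating_function\<close>). The expansion itself is the reflection formula of the
  trigamma function, obtained by differentiating Euler's reflection formula for
  \<open>\<Gamma>\<close> logarithmically and then once more.

  At a root \<open>r\<close> of \<open>r\<^sup>2 = r + 1\<close> the removed poles become powers of \<open>r\<close>, because
  \<open>1 - r = -1 / r\<close> and \<open>1 + r = r\<^sup>2\<close>; they give the terms with \<open>9\<close> and \<open>7\<close>. The two sines
  \<open>sin(\<pi> \<phi>)\<close> and \<open>sin(\<pi> \<psi>)\<close> both equal \<open>cos(\<surd>5 \<pi> / 2)\<close>, so the factor with the secant is common to both
  roots and survives the linear combination.
\<close>

section \<open>Partial fractions of the squared cosecant\<close>

text \<open>The logarithmic derivative of Euler's reflection formula. It is taken for the entire function
  \<open>1 / \<Gamma>\<close> rather than for \<open>ln \<Gamma>\<close>, so negative arguments need no separate treatment.\<close>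

lemma Digamma_reflection_real:
  fixes x :: real
  assumes x: "x \<notin> \<int>"
  shows "Digamma (1 - x) - Digamma x = pi * cot (pi * x)"
proof -
  have nx: "x \<notin> \<int>\<^sub>\<le>\<^sub>0" and n1x: "1 - x \<notin> \<int>\<^sub>\<le>\<^sub>0"
    using x nonpos_Ints_subset_Ints Ints_diff[of 1 "1 - x"] by auto
  have refl: "rGamma y * rGamma (1 - y) = sin (pi * y) / pi" for y :: real
  proof -
    have "complex_of_real (rGamma y * rGamma (1 - y)) = of_real (sin (pi * y) / pi)"
      using rGamma_reflection_complex[of "of_real y"]
      by (simp flip: rGamma_complex_of_real sin_of_real)
    then show ?thesis using of_real_eq_iff by blast
  qed
  have "((\<lambda>y. rGamma y * rGamma (1 - y)) has_real_derivative
          rGamma x * rGamma (1 - x) * (Digamma (1 - x) - Digamma x)) (at x)"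
    using nx n1x by (auto intro!: derivative_eq_intros simp: algebra_simps)
  moreover have "((\<lambda>y. sin (pi * y) / pi) has_real_derivative cos (pi * x)) (at x)"
    by (auto intro!: derivative_eq_intros)
  ultimately have "sin (pi * x) / pi * (Digamma (1 - x) - Digamma x) = cos (pi * x)"
    unfolding refl by (rule DERIV_unique)
  moreover have "sin (pi * x) \<noteq> 0"
    using x by (auto simp: sin_zero_iff_int2)
  ultimately show ?thesis by (simp add: cot_def field_simps)
qed

lemma Trigamma_reflection_real:
  fixes x :: real
  assumes x: "x \<notin> \<int>"
  shows "Polygamma 1 x + Polygamma 1 (1 - x) = pi\<^sup>2 / (sin (pi * x))\<^sup>2"
proof -
  have nx: "x \<notin> \<int>\<^sub>\<le>\<^sub>0" and n1x: "1 - x \<notin> \<int>\<^sub>\<le>\<^sub>0"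
    using x nonpos_Ints_subset_Ints Ints_diff[of 1 "1 - x"] by auto
  have s: "sin (pi * x) \<noteq> 0"
    using x by (auto simp: sin_zero_iff_int2)
  have "((\<lambda>y. Digamma (1 - y) - Digamma y) has_real_derivative
          - (Polygamma 1 x + Polygamma 1 (1 - x))) (at x)"
    using nx n1x by (auto intro!: derivative_eq_intros)
  moreover have "((\<lambda>y. pi * cot (pi * y)) has_real_derivative - (pi\<^sup>2 / (sin (pi * x))\<^sup>2)) (at x)"
  proof -
    have "((\<lambda>y. cot (pi * y)) has_real_derivative - inverse ((sin (pi * x))\<^sup>2) * pi) (at x)"
      by (rule DERIV_chain2[where g = "\<lambda>y. pi * y", OF DERIV_cot[OF s]])
        (auto intro!: derivative_eq_intros)
    from DERIV_cmult[OF this, of pi] show ?thesis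
      by (simp add: divide_inverse power2_eq_square mult_ac)
  qed
  then have "((\<lambda>y. Digamma (1 - y) - Digamma y) has_real_derivative - (pi\<^sup>2 / (sin (pi * x))\<^sup>2)) (at x)"
    by (rule has_field_derivative_transform_within_open[where S = "- \<int>"])
      (use x in \<open>simp_all add: Digamma_reflection_real open_Compl closed_Ints\<close>)
  ultimately have "- (Polygamma 1 x + Polygamma 1 (1 - x)) = - (pi\<^sup>2 / (sin (pi * x))\<^sup>2)"
    by (rule DERIV_unique)
  then show ?thesis by (simp only: neg_equal_iff_equal)
qed

text \<open>This is the expansion of \<open>\<pi>\<^sup>2 / sin\<^sup>2(\<pi> x)\<close> over all integer poles, without those at \<open>0\<close> and \<open>\<plusminus>1\<close>.
  The trigamma series at \<open>1 - x\<close> and at \<open>x\<close> run over the poles \<open>n \<ge> 1\<close> and \<open>n \<le> 0\<close>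
  respectively; dropping the first term of one and the first two of the other leaves \<open>\<bar>n\<bar> \<ge> 2\<close>.\<close>

lemma sums_inverse_squares_from_2:
  fixes x :: real
  assumes x: "x \<notin> \<int>"
  shows "(\<lambda>n. 1 / (real n + 2 - x)\<^sup>2 + 1 / (real n + 2 + x)\<^sup>2) sums
           (pi\<^sup>2 / (sin (pi * x))\<^sup>2 - 1 / x\<^sup>2 - 1 / (1 - x)\<^sup>2 - 1 / (1 + x)\<^sup>2)"
proof -
  have "x \<noteq> 0" "1 - x \<noteq> 0" using x by auto
  have a: "(\<lambda>k. 1 / (1 - x + real k)\<^sup>2) sums Polygamma 1 (1 - x)"
    using Polygamma_LIMSEQ[OF \<open>1 - x \<noteq> 0\<close>, of 1] by (simp add: numeral_2_eq_2 inverse_eq_divide)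
  have b: "(\<lambda>k. 1 / (x + real k)\<^sup>2) sums Polygamma 1 x"
    using Polygamma_LIMSEQ[OF \<open>x \<noteq> 0\<close>, of 1] by (simp add: numeral_2_eq_2 inverse_eq_divide)
  have "(\<lambda>n. 1 / (real n + 2 - x)\<^sup>2) sums (Polygamma 1 (1 - x) - 1 / (1 - x)\<^sup>2)"
    using sums_split_initial_segment[OF a, of 1] by (simp add: algebra_simps)
  moreover have "(\<lambda>n. 1 / (real n + 2 + x)\<^sup>2) sums (Polygamma 1 x - (1 / x\<^sup>2 + 1 / (1 + x)\<^sup>2))"
    using sums_split_initial_segment[OF b, of 2] by (simp add: algebra_simps numeral_2_eq_2)
  ultimately have "(\<lambda>n. 1 / (real n + 2 - x)\<^sup>2 + 1 / (real n + 2 + x)\<^sup>2) sums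
      (Polygamma 1 (1 - x) - 1 / (1 - x)\<^sup>2 + (Polygamma 1 x - (1 / x\<^sup>2 + 1 / (1 + x)\<^sup>2)))"
    by (rule sums_add)
  then show ?thesis using Trigamma_reflection_real[OF x] by (simp add: algebra_simps)
qed

section \<open>A generating function for even zeta values\<close>

lemma zeta_even_minus_one_sums:
  assumes "k \<ge> 1"
  shows "(\<lambda>n. 1 / (real n + 2) ^ (2 * k)) sums (zeta (2 * real k) - 1)"
proof -
  let ?f = "\<lambda>n. 1 / real (Suc n) powr (2 * real k)"
  have eq: "?f n = 1 / (real n + 1) ^ (2 * k)" for n
    using powr_realpow[of "real (Suc n)" "2 * k"] by (simp add: add.commute)
  have "summable (\<lambda>n. real (Suc n) powr - (2 * real k))"
    using assms summable_real_powr_iff[of "- (2 * real k)"] by (subst summable_Suc_iff) simp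
  then have "?f sums zeta (2 * real k)"
    unfolding zeta_def by (intro summable_sums) (simp add: powr_minus_divide)
  from sums_split_initial_segment[OF this, of 1] show ?thesis
    unfolding eq by (simp add: algebra_simps)
qed

text \<open>The weight \<open>2k - 1\<close> is what makes this series a sum of two exact squares of simple fractions:
  for \<open>y = (x / a)\<^sup>2\<close> it gives \<open>\<Sum>\<^sub>k (2k - 1) y\<^sup>k = y (1 + y) / (1 - y)\<^sup>2\<close>, and
  \<open>2 (a\<^sup>2 + x\<^sup>2) = (a - x)\<^sup>2 + (a + x)\<^sup>2\<close>.\<close>

lemma odd_weighted_geometric_sums:
  fixes x a :: real
  assumes "\<bar>x\<bar> < a"
  shows "(\<lambda>j. (2 * real j + 1) * (x / a) ^ (2 * Suc j)) sums
           (x\<^sup>2 / 2 * (1 / (a - x)\<^sup>2 + 1 / (a + x)\<^sup>2))"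
proof -
  define y where "y = (x / a)\<^sup>2"
  have a: "a > 0" and nz: "a - x \<noteq> 0" "a + x \<noteq> 0" using assms by auto
  have y1: "norm y < 1"
    using assms a by (simp add: y_def abs_square_less_1)
  have "(\<lambda>j. y * (2 * (real (Suc j) * y ^ j) - y ^ j)) sums (y * (2 * (1 / (1 - y)\<^sup>2) - 1 / (1 - y)))"
    using geometric_deriv_sums[OF y1] geometric_sums[OF y1]
    by (intro sums_mult sums_diff) auto
  moreover have "y * (2 * (real (Suc j) * y ^ j) - y ^ j) = (2 * real j + 1) * (x / a) ^ (2 * Suc j)" for j
    unfolding power_mult y_def[symmetric] by (simp add: algebra_simps)
  moreover have "y * (2 * (1 / (1 - y)\<^sup>2) - 1 / (1 - y)) = x\<^sup>2 / 2 * (1 / (a - x)\<^sup>2 + 1 / (a + x)\<^sup>2)"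
  proof -
    have "1 - y = (a - x) * (a + x) / a\<^sup>2"
      using a by (simp add: y_def field_simps power2_eq_square)
    then have y: "1 / (1 - y) = a\<^sup>2 / ((a - x) * (a + x))" by simp
    have "y * (2 * (1 / (1 - y)\<^sup>2) - 1 / (1 - y)) = y * (1 / (1 - y)) * (2 * (1 / (1 - y)) - 1)"
      by (simp add: power2_eq_square algebra_simps)
    also have "y * (1 / (1 - y)) = x\<^sup>2 / ((a - x) * (a + x))"
      unfolding y using a by (simp add: y_def power_divide)
    also have "2 * (1 / (1 - y)) - 1 = (a\<^sup>2 + x\<^sup>2) / ((a - x) * (a + x))"
      unfolding y using nz by (simp add: divide_simps) (simp add: power2_eq_square algebra_simps)
    also have "(a\<^sup>2 + x\<^sup>2) / ((a - x) * (a + x)) =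
                 (a - x) * (a + x) / 2 * (1 / (a - x)\<^sup>2 + 1 / (a + x)\<^sup>2)"
      using nz by (simp add: divide_simps) (simp add: power2_eq_square algebra_simps)
    finally show ?thesis using nz by simp
  qed
  ultimately show ?thesis by (simp only:)
qed

text \<open>Tonelli's theorem for double series; summability of \<open>h\<close> is part of the conclusion.\<close>

lemma sums_swap_nonneg:
  fixes f :: "nat \<Rightarrow> nat \<Rightarrow> real"
  assumes "\<And>n j. f n j \<ge> 0"
    and "\<And>n. f n sums g n" and "g sums S" and "\<And>j. (\<lambda>n. f n j) sums h j"
  shows "h sums S"
proof -
  have g0: "g n \<ge> 0" for n using sums_le[OF _ sums_zero assms(2)] assms(1) by blast
  have r: "(f n has_sum g n) UNIV" and c: "((\<lambda>n. f n j) has_sum h j) UNIV" for n j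
    using assms by (auto intro: sums_nonneg_imp_has_sum)
  have G: "(g has_sum S) UNIV" using assms(3) g0 by (rule sums_nonneg_imp_has_sum)
  have "(\<lambda>(n, j). f n j) summable_on UNIV \<times> UNIV"
    using r G assms(1) by (intro summable_on_SigmaI[where g = g]) (simp_all add: has_sum_imp_summable)
  then have "((\<lambda>(n, j). f n j) has_sum S) (UNIV \<times> UNIV)"
    using r G by (intro has_sum_SigmaI[where g = g]) simp_all
  then have "((\<lambda>(j, n). f n j) has_sum S) (UNIV \<times> UNIV)"
    by (simp only: has_sum_swap[of "\<lambda>(n, j). f n j"] prod.case)
  then have "(h has_sum S) UNIV"
    by (rule has_sum_SigmaD) (simp only: prod.case c)
  then show ?thesis by (rule has_sum_imp_sums)
qed

text \<open>The radius of convergence is \<open>2\<close>, not \<open>1\<close>, because subtracting \<open>1\<close> from \<open>\<zeta>(2k)\<close> removes the term \<open>n = 1\<close>.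
  This is what allows \<open>x\<close> to be the golden ratio later.\<close>

lemma zeta_even_generating_function:
  fixes x :: real
  assumes x: "x \<notin> \<int>" and "\<bar>x\<bar> < 2"
  shows "(\<lambda>j. (2 * real j + 1) * (zeta (2 * real (Suc j)) - 1) * x ^ (2 * Suc j)) sums
     (x\<^sup>2 / 2 * (pi\<^sup>2 / (sin (pi * x))\<^sup>2 - 1 / x\<^sup>2 - 1 / (1 - x)\<^sup>2 - 1 / (1 + x)\<^sup>2))"
proof (rule sums_swap_nonneg)
  show "(\<lambda>j. (2 * real j + 1) * (x / (real n + 2)) ^ (2 * Suc j)) sums
          (x\<^sup>2 / 2 * (1 / (real n + 2 - x)\<^sup>2 + 1 / (real n + 2 + x)\<^sup>2))" for n
    using assms(2) by (intro odd_weighted_geometric_sums) auto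
  show "(2 * real j + 1) * (x / (real n + 2)) ^ (2 * Suc j) \<ge> 0" for n j
    by (intro mult_nonneg_nonneg zero_le_even_power) auto
  show "(\<lambda>n. x\<^sup>2 / 2 * (1 / (real n + 2 - x)\<^sup>2 + 1 / (real n + 2 + x)\<^sup>2)) sums
     (x\<^sup>2 / 2 * (pi\<^sup>2 / (sin (pi * x))\<^sup>2 - 1 / x\<^sup>2 - 1 / (1 - x)\<^sup>2 - 1 / (1 + x)\<^sup>2))"
    by (intro sums_mult sums_inverse_squares_from_2 x)
  fix j :: nat
  have Suc_ge_1: "Suc j \<ge> 1" by simp
  show "(\<lambda>n. (2 * real j + 1) * (x / (real n + 2)) ^ (2 * Suc j)) sums
          ((2 * real j + 1) * (zeta (2 * real (Suc j)) - 1) * x ^ (2 * Suc j))"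
    using sums_mult[OF zeta_even_minus_one_sums[OF Suc_ge_1], of "(2 * real j + 1) * x ^ (2 * Suc j)"]
    by (simp only: power_divide mult_ac times_divide_eq_right mult_1_left mult_1_right)
qed

section \<open>Evaluation at the golden ratio and its conjugate\<close>

text \<open>The contribution of one root of \<open>r\<^sup>2 = r + 1\<close>. An integer root would satisfy
  \<open>r (r - 1) = 1\<close>, which is impossible, so the generating function applies.\<close>

lemma golden_root_sums:
  fixes r :: real
  assumes root: "r\<^sup>2 = r + 1" and "\<bar>r\<bar> < 2" and "m \<ge> 1"
  shows "(\<lambda>j. (2 * real j + 1) * (zeta (2 * real (Suc j)) - 1) * r ^ (2 * Suc j + m + 1)) sums
     (pi\<^sup>2 / 2 / (sin (pi * r))\<^sup>2 * r ^ (m + 3) - (9 * r ^ m + 7 * r ^ (m - 1)) / 2)"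
proof -
  have "r \<notin> \<int>"
  proof
    assume "r \<in> \<int>"
    then obtain i :: int where i: "r = of_int i" by (auto elim: Ints_cases)
    have "of_int (i\<^sup>2) = (of_int (i + 1) :: real)" using root i by simp
    then have "i\<^sup>2 = i + 1" by (simp only: of_int_eq_iff)
    then have "i * (i - 1) = 1" by (simp add: power2_eq_square algebra_simps)
    then show False using zmult_eq_1_iff[of i "i-1"] by auto
  qed
  then have r: "r \<noteq> 0" "r \<noteq> 1" by auto
  obtain p where m: "m = Suc p" using \<open>m \<ge> 1\<close> by (cases m) auto
  \<comment> \<open>The next two facts turn the poles at \<open>1\<close> and \<open>-1\<close> into powers of \<open>r\<close>: \<open>1 - r = -1 / r\<close>, \<open>1 + r = r\<^sup>2\<close>.\<close>
  have i1: "1 / (1 - r)\<^sup>2 = r\<^sup>2"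
  proof -
    have "(1 - r) * r = - 1" using root by (simp add: power2_eq_square algebra_simps)
    then have "((1 - r) * r)\<^sup>2 = 1" by simp
    then have "(1 - r)\<^sup>2 * r\<^sup>2 = 1" by (simp only: power_mult_distrib)
    then show ?thesis using r by (simp add: divide_eq_eq mult.commute)
  qed
  have i2: "1 / (1 + r)\<^sup>2 = 1 / r ^ 4"
  proof -
    have "(1 + r)\<^sup>2 = (r\<^sup>2)\<^sup>2" unfolding root by (simp add: add.commute)
    then show ?thesis by simp
  qed
  have red: "r ^ 4 = 3 * r + 2"
  proof -
    have "r ^ 4 = (r\<^sup>2)\<^sup>2" by simp
    also have "\<dots> = (r + 1)\<^sup>2" by (simp only: root)
    also have "\<dots> = r\<^sup>2 + 2 * r + 1" by (simp add: power2_eq_square algebra_simps)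
    finally show ?thesis using root by simp
  qed
  have "r ^ (m + 1) * (r\<^sup>2 / 2 * (1 / r\<^sup>2 + r\<^sup>2 + 1 / r ^ 4)) = r ^ p * (r\<^sup>2 + r ^ 4 * r\<^sup>2 + 1) / 2"
    using r by (simp add: m field_simps power2_eq_square power4_eq_xxxx)
  also have "r\<^sup>2 + r ^ 4 * r\<^sup>2 + 1 = 9 * r + 7"
    unfolding red root using root by (simp add: power2_eq_square algebra_simps)
  finally have tail: "r ^ (m + 1) * (r\<^sup>2 / 2 * (1 / r\<^sup>2 + r\<^sup>2 + 1 / r ^ 4)) = (9 * r ^ m + 7 * r ^ (m - 1)) / 2"
    by (simp add: m algebra_simps)
  have "(\<lambda>j. r ^ (m + 1) * ((2 * real j + 1) * (zeta (2 * real (Suc j)) - 1) * r ^ (2 * Suc j))) sums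
    (r ^ (m + 1) * (r\<^sup>2 / 2 * (pi\<^sup>2 / (sin (pi * r))\<^sup>2 - 1 / r\<^sup>2 - 1 / (1 - r)\<^sup>2 - 1 / (1 + r)\<^sup>2)))"
    by (intro sums_mult zeta_even_generating_function \<open>r \<notin> \<int>\<close> assms)
  also have "r ^ (m + 1) * (r\<^sup>2 / 2 * (pi\<^sup>2 / (sin (pi * r))\<^sup>2 - 1 / r\<^sup>2 - 1 / (1 - r)\<^sup>2 - 1 / (1 + r)\<^sup>2))
     = pi\<^sup>2 / 2 / (sin (pi * r))\<^sup>2 * r ^ (m + 3) - r ^ (m + 1) * (r\<^sup>2 / 2 * (1 / r\<^sup>2 + r\<^sup>2 + 1 / r ^ 4))"
    unfolding i1 i2 by (simp add: algebra_simps power_add numeral_3_eq_3 power2_eq_square)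
  finally show ?thesis unfolding tail by (simp add: power_add mult_ac)
qed

lemma golden_ratio_squared: "((1 + sqrt 5) / 2)\<^sup>2 = (1 + sqrt 5) / 2 + 1"
  and golden_ratio_conjugate_squared: "((1 - sqrt 5) / 2)\<^sup>2 = (1 - sqrt 5) / 2 + 1"
  by (simp_all add: power_divide power2_sum power2_diff add_divide_distrib diff_divide_distrib)

lemma lucas_closed_form:
  "real (lucas n) = ((1 + sqrt 5) / 2) ^ n + ((1 - sqrt 5) / 2) ^ n"
proof (induction n rule: lucas.induct)
  case (3 n)
  have step: "r ^ Suc (Suc n) = r ^ Suc n + r ^ n" if "r\<^sup>2 = r + 1" for r :: real
  proof -
    have "r ^ Suc (Suc n) = r ^ n * r\<^sup>2" by (simp add: power2_eq_square)
    then show ?thesis unfolding that by (simp add: algebra_simps)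
  qed
  show ?case
    unfolding step[OF golden_ratio_squared] step[OF golden_ratio_conjugate_squared]
    using 3 by simp
qed (auto simp: field_simps)

theorem theorem2p0p1:
  fixes m :: nat
  assumes "m \<ge> 2"
  shows "((\<lambda>j. let k = Suc j in
            (2 * real k - 1) * (zeta (2 * real k) - 1) * real (fib (2 * k + m + 1)))
          sums (pi\<^sup>2 / 2 * (1 / cos (sqrt 5 * pi / 2))\<^sup>2 * real (fib (m + 3))
                - (9 * real (fib m) + 7 * real (fib (m - 1))) / 2)) \<and>
         ((\<lambda>j. let k = Suc j in
            (2 * real k - 1) * (zeta (2 * real k) - 1) * real (lucas (2 * k + m + 1)))
          sums (pi\<^sup>2 / 2 * (1 / cos (sqrt 5 * pi / 2))\<^sup>2 * real (lucas (m + 3))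
                - (9 * real (lucas m) + 7 * real (lucas (m - 1))) / 2))"
proof -
  define \<phi> \<psi> :: real where "\<phi> = (1 + sqrt 5) / 2" and "\<psi> = (1 - sqrt 5) / 2"
  \<comment> \<open>Crude bounds that put both roots into the disc of convergence.\<close>
  have s5: "sqrt 5 < 3" "sqrt 5 > 1" by (auto intro: real_less_lsqrt real_less_rsqrt)
  define c where "c j = (2 * real j + 1) * (zeta (2 * real (Suc j)) - 1)" for j
  define A where "A = pi\<^sup>2 / 2 * (1 / cos (sqrt 5 * pi / 2))\<^sup>2"
  have "sin (pi * \<phi>) = sin (pi / 2 + sqrt 5 * pi / 2)"
    and "sin (pi * \<psi>) = sin (pi / 2 - sqrt 5 * pi / 2)"
    by (simp_all add: \<phi>_def \<psi>_def field_simps)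
  then have s: "sin (pi * \<phi>) = cos (sqrt 5 * pi / 2)" "sin (pi * \<psi>) = cos (sqrt 5 * pi / 2)"
    by (simp_all add: sin_add sin_diff)
  have S: "(\<lambda>j. c j * r ^ (2 * Suc j + m + 1)) sums (A * r ^ (m + 3) - (9 * r ^ m + 7 * r ^ (m - 1)) / 2)"
    if "r \<in> {\<phi>, \<psi>}" for r
  proof -
    have "r\<^sup>2 = r + 1"
      using that golden_ratio_squared golden_ratio_conjugate_squared
      unfolding \<phi>_def \<psi>_def by blast
    moreover have "\<bar>\<phi>\<bar> < 2" "\<bar>\<psi>\<bar> < 2"
      using s5 unfolding \<phi>_def \<psi>_def
      by (simp_all only: abs_less_iff) (simp_all add: field_simps add_pos_pos)
    then have "\<bar>r\<bar> < 2" using that by blast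
    ultimately have "(\<lambda>j. c j * r ^ (2 * Suc j + m + 1)) sums
      (pi\<^sup>2 / 2 / (sin (pi * r))\<^sup>2 * r ^ (m + 3) - (9 * r ^ m + 7 * r ^ (m - 1)) / 2)"
      unfolding c_def using assms by (intro golden_root_sums) auto
    then show ?thesis using that s by (auto simp: A_def power_divide)
  qed
  \<comment> \<open>The asserted identity for any solution \<open>g\<close> of the recurrence, written in Binet form.\<close>
  have comb: "(\<lambda>j. c j * g (2 * Suc j + m + 1)) sums (A * g (m + 3) - (9 * g m + 7 * g (m - 1)) / 2)"
    if g: "\<And>n. g n = \<alpha> * \<phi> ^ n + \<beta> * \<psi> ^ n" for g \<alpha> \<beta>
  proof -
    have "(\<lambda>j. \<alpha> * (c j * \<phi> ^ (2 * Suc j + m + 1)) + \<beta> * (c j * \<psi> ^ (2 * Suc j + m + 1))) sums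
      (\<alpha> * (A * \<phi> ^ (m + 3) - (9 * \<phi> ^ m + 7 * \<phi> ^ (m - 1)) / 2)
        + \<beta> * (A * \<psi> ^ (m + 3) - (9 * \<psi> ^ m + 7 * \<psi> ^ (m - 1)) / 2))"
      by (intro sums_add sums_mult S) auto
    moreover have "\<alpha> * (c j * \<phi> ^ (2 * Suc j + m + 1)) + \<beta> * (c j * \<psi> ^ (2 * Suc j + m + 1)) =
        c j * g (2 * Suc j + m + 1)" for j
      unfolding g by (simp only: distrib_left mult.left_commute)
    moreover have "\<alpha> * (A * \<phi> ^ (m + 3) - (9 * \<phi> ^ m + 7 * \<phi> ^ (m - 1)) / 2)
        + \<beta> * (A * \<psi> ^ (m + 3) - (9 * \<psi> ^ m + 7 * \<psi> ^ (m - 1)) / 2) =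
        A * g (m + 3) - (9 * g m + 7 * g (m - 1)) / 2"
      unfolding g by (simp add: algebra_simps add_divide_distrib)
    ultimately show ?thesis by (simp only:)
  qed
  have w: "2 * real (Suc j) - 1 = 2 * real j + 1" for j by simp
  have "real (fib n) = 1 / sqrt 5 * \<phi> ^ n + (- 1 / sqrt 5) * \<psi> ^ n" for n
    unfolding fib_closed_form \<phi>_def \<psi>_def by (simp add: diff_divide_distrib)
  note F = comb[of "\<lambda>n. real (fib n)", OF this]
  have "real (lucas n) = 1 * \<phi> ^ n + 1 * \<psi> ^ n" for n
    unfolding lucas_closed_form \<phi>_def \<psi>_def by simp
  note L = comb[of "\<lambda>n. real (lucas n)", OF this]
  show ?thesis using F L unfolding Let_def w c_def A_def by blast
qed
end
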